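(* Let $L$ be a compact Hausdorff space and let $\mathcal{A}\subseteq\mathcal{C}(L,\mathbb{R})$ be an algebra over $\mathbb{R}$ that vanishes nowhere on $L$ and such that the equivalence relation $\sim_{\mathcal{A}}$ is finite. Then $\mathcal{C}(L,\mathbb{R})\setminus\overline{\mathcal{A}}$ is $\mathrm{ord}(\sim_{\mathcal{A}})$-latticeable but not $(\mathrm{ord}(\sim_{\mathcal{A}})+1)$-latticeable.
   Context: $\mathcal{C}(L,\mathbb{R})$ is the Banach lattice of continuous functions $L\to\mathbb{R}$ with the sup-norm and pointwise order; $\overline{\mathcal{A}}$ is the norm closure. An algebra is a linear subspace closed under products (not necessarily containing constants). $\mathcal{A}$ vanishes nowhere on $L$ if for every $x\in L$ there is $f\in\mathcal{A}$ with $f(x)\neq 0$. The relation $\sim_{\mathcal{A}}$ on $L$ is defined by $x\sim_{\mathcal{A}}y$ iff $f(x)=f(y)$ for all $f\in\mathcal{A}$. For an equivalence relation $\rho$ on $L$, a set of representatives is a subset $R\subseteq L$ containing exactly one element of each equivalence class; the cardinal $\mathrm{ord}(\rho):=|L\setminus R|$ does not depend on the choice of $R$ and is called the order of $\rho$. The relation $\rho$ is finite if $\mathrm{ord}(\rho)$ is finite. Given a Banach lattice $V$, a subset $M\subseteq V$ and a cardinal $\kappa$, $M$ is $\kappa$-latticeable if $M\cup\{0\}$ contains a sublattice $W$ of $V$ (a linear subspace closed under the lattice operations of $V$) of dimension $\kappa$. *)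

theory Defs
  imports "HOL-Analysis.Analysis"
begin

unbundle cardinal_syntax
no_notation Set_Algebras.elt_set_eq (infix \<open>=o\<close> 50)

section \<open>The Banach lattice and algebra of continuous functions\<close>

text \<open>
  For a compact space \<open>'a\<close> every continuous function \<open>'a \<Rightarrow> real\<close> is bounded, so the library type
  \<open>'a \<Rightarrow>\<^sub>C real\<close>, with its sup-norm, is the space of all continuous functions. The library provides
  neither its pointwise product nor its pointwise order.
\<close>

lemma compact_UNIV_bcontfun_iff:
  fixes f :: "'a::topological_space \<Rightarrow> 'b::metric_space"
  assumes "compact (UNIV :: 'a set)"
  shows "f \<in> bcontfun \<longleftrightarrow> continuous_on UNIV f"
  using assms by (auto simp: bcontfun_def intro: compact_imp_bounded compact_continuous_image)

unbundle bcontfun.lifting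

instantiation bcontfun :: (topological_space, real_normed_algebra) real_normed_algebra
begin

lift_definition times_bcontfun :: "('a \<Rightarrow>\<^sub>C 'b) \<Rightarrow> ('a \<Rightarrow>\<^sub>C 'b) \<Rightarrow> 'a \<Rightarrow>\<^sub>C 'b"
  is "\<lambda>f g x. f x * g x"
proof -
  fix f g :: "'a \<Rightarrow> 'b"
  assume f: "f \<in> bcontfun" and g: "g \<in> bcontfun"
  from f obtain a where a: "\<And>x. norm (f x) \<le> a" by (auto simp: bcontfun_def bounded_iff)
  from g obtain b where b: "\<And>x. norm (g x) \<le> b" by (auto simp: bcontfun_def bounded_iff)
  have "norm (f x * g x) \<le> a * b" for x
    by (meson a b mult_mono' norm_ge_zero norm_mult_ineq order_trans)
  then show "(\<lambda>x. f x * g x) \<in> bcontfun"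
    using f g by (intro bcontfun_normI) (auto simp: bcontfun_def intro!: continuous_on_mult)
qed

instance
proof
  fix f g h :: "'a \<Rightarrow>\<^sub>C 'b" and r :: real
  show "f * g * h = f * (g * h)" by transfer (simp add: mult.assoc)
  show "(f + g) * h = f * h + g * h" by transfer (simp add: distrib_right)
  show "f * (g + h) = f * g + f * h" by transfer (simp add: distrib_left)
  show "r *\<^sub>R f * g = r *\<^sub>R (f * g)" by transfer simp
  show "f * r *\<^sub>R g = r *\<^sub>R (f * g)" by transfer simp
  show "norm (f * g) \<le> norm f * norm g"
  proof (rule norm_bound)
    fix x
    have "norm (apply_bcontfun (f * g) x) \<le> norm (apply_bcontfun f x) * norm (apply_bcontfun g x)"
      by (simp add: times_bcontfun.rep_eq norm_mult_ineq)
    also have "\<dots> \<le> norm f * norm g"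
      by (intro mult_mono norm_bounded) auto
    finally show "norm (apply_bcontfun (f * g) x) \<le> norm f * norm g" .
  qed
qed

end

instantiation bcontfun :: (topological_space, "{metric_space, linorder_topology}") lattice
begin

lift_definition less_eq_bcontfun :: "('a \<Rightarrow>\<^sub>C 'b) \<Rightarrow> ('a \<Rightarrow>\<^sub>C 'b) \<Rightarrow> bool"
  is "\<lambda>f g. \<forall>x. f x \<le> g x" .

definition less_bcontfun :: "('a \<Rightarrow>\<^sub>C 'b) \<Rightarrow> ('a \<Rightarrow>\<^sub>C 'b) \<Rightarrow> bool"
  where "less_bcontfun f g \<longleftrightarrow> f \<le> g \<and> \<not> g \<le> f"

lift_definition inf_bcontfun :: "('a \<Rightarrow>\<^sub>C 'b) \<Rightarrow> ('a \<Rightarrow>\<^sub>C 'b) \<Rightarrow> 'a \<Rightarrow>\<^sub>C 'b"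
  is "\<lambda>f g x. min (f x) (g x)"
proof -
  fix f g :: "'a \<Rightarrow> 'b"
  assume f: "f \<in> bcontfun" and g: "g \<in> bcontfun"
  have "bounded (range f \<union> range g)"
    using f g by (simp add: bcontfun_def)
  then have "bounded (range (\<lambda>x. min (f x) (g x)))"
    by (rule bounded_subset) (auto simp: min_def)
  moreover have "continuous_on UNIV (\<lambda>x. min (f x) (g x))"
    using f g by (intro continuous_on_min) (simp_all add: bcontfun_def)
  ultimately show "(\<lambda>x. min (f x) (g x)) \<in> bcontfun"
    by (simp add: bcontfun_def)
qed

lift_definition sup_bcontfun :: "('a \<Rightarrow>\<^sub>C 'b) \<Rightarrow> ('a \<Rightarrow>\<^sub>C 'b) \<Rightarrow> 'a \<Rightarrow>\<^sub>C 'b"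
  is "\<lambda>f g x. max (f x) (g x)"
proof -
  fix f g :: "'a \<Rightarrow> 'b"
  assume f: "f \<in> bcontfun" and g: "g \<in> bcontfun"
  have "bounded (range f \<union> range g)"
    using f g by (simp add: bcontfun_def)
  then have "bounded (range (\<lambda>x. max (f x) (g x)))"
    by (rule bounded_subset) (auto simp: max_def)
  moreover have "continuous_on UNIV (\<lambda>x. max (f x) (g x))"
    using f g by (intro continuous_on_max) (simp_all add: bcontfun_def)
  ultimately show "(\<lambda>x. max (f x) (g x)) \<in> bcontfun"
    by (simp add: bcontfun_def)
qed

instance
proof
  fix f g h :: "'a \<Rightarrow>\<^sub>C 'b"
  show "f < g \<longleftrightarrow> f \<le> g \<and> \<not> g \<le> f" by (rule less_bcontfun_def)
  show "f \<le> f" by transfer simp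
  show "f \<le> g \<Longrightarrow> g \<le> h \<Longrightarrow> f \<le> h" by transfer (blast intro: order_trans)
  show "f \<le> g \<Longrightarrow> g \<le> f \<Longrightarrow> f = g" by transfer (blast intro: antisym)
  show "inf f g \<le> f" "inf f g \<le> g" by (transfer, simp)+
  show "f \<le> g \<Longrightarrow> f \<le> h \<Longrightarrow> f \<le> inf g h" by transfer simp
  show "f \<le> sup f g" "g \<le> sup f g" by (transfer, simp)+
  show "g \<le> f \<Longrightarrow> h \<le> f \<Longrightarrow> sup g h \<le> f" by transfer simp
qed

end

lifting_update bcontfun.lifting
lifting_forget bcontfun.lifting

definition subalgebra :: "'v::real_algebra set \<Rightarrow> bool"
  where "subalgebra A \<longleftrightarrow> subspace A \<and> (\<forall>f\<in>A. \<forall>g\<in>A. f * g \<in> A)"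

definition vanishes_nowhere :: "('a::topological_space \<Rightarrow>\<^sub>C real) set \<Rightarrow> bool"
  where "vanishes_nowhere A \<longleftrightarrow> (\<forall>x. \<exists>f\<in>A. apply_bcontfun f x \<noteq> 0)"

definition same_values_rel :: "('a::topological_space \<Rightarrow>\<^sub>C real) set \<Rightarrow> 'a rel"
  where "same_values_rel A = {(x, y). \<forall>f\<in>A. apply_bcontfun f x = apply_bcontfun f y}"

lemma equiv_same_values_rel: "equiv UNIV (same_values_rel A)"
  by (rule equivI) (auto simp: same_values_rel_def refl_on_def sym_def trans_def)


section \<open>The order of an equivalence relation\<close>

definition representatives :: "'a set \<Rightarrow> 'a rel \<Rightarrow> 'a set \<Rightarrow> bool"
  where "representatives L \<rho> R \<longleftrightarrow> R \<subseteq> L \<and> (\<forall>C \<in> L // \<rho>. \<exists>!x. x \<in> R \<inter> C)"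

text \<open>
  The order is a cardinal, represented as usual by a well-order of minimal order type. It is
  independent of the chosen set of representatives, up to the equality \<open>=o\<close> of cardinals: see
  \<open>equiv_ord_eq\<close> below.
\<close>

definition equiv_ord :: "'a set \<Rightarrow> 'a rel \<Rightarrow> 'a rel"
  where "equiv_ord L \<rho> = |L - (SOME R. representatives L \<rho> R)|"

definition finite_equiv :: "'a set \<Rightarrow> 'a rel \<Rightarrow> bool"
  where "finite_equiv L \<rho> \<longleftrightarrow> BNF_Cardinal_Arithmetic.cfinite (equiv_ord L \<rho>)"

lemma representatives_exist:
  assumes "equiv L \<rho>"
  shows "\<exists>R. representatives L \<rho> R"
proof -
  define c where "c C = (SOME x. x \<in> C)" for C :: "'a set"
  have c: "c C \<in> C" if "C \<in> L // \<rho>" for C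
    unfolding c_def using in_quotient_imp_non_empty[OF assms that] by (simp add: some_in_eq)
  have "representatives L \<rho> (c ` (L // \<rho>))"
    unfolding representatives_def
  proof (intro conjI ballI)
    show "c ` (L // \<rho>) \<subseteq> L"
      using c in_quotient_imp_subset[OF assms] by blast
    fix C assume C: "C \<in> L // \<rho>"
    show "\<exists>!x. x \<in> c ` (L // \<rho>) \<inter> C"
    proof (rule ex1I[of _ "c C"])
      show "c C \<in> c ` (L // \<rho>) \<inter> C" using C c by blast
      fix x assume "x \<in> c ` (L // \<rho>) \<inter> C"
      then obtain D where D: "D \<in> L // \<rho>" "x = c D" "x \<in> C" by blast
      with c[of D] quotient_disj[OF assms C D(1)] show "x = c C" by blast
    qed
  qed
  then show ?thesis by blast
qed

lemma representatives_complement_unique: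
  assumes eq: "equiv L \<rho>" and R: "representatives L \<rho> R" and S: "representatives L \<rho> S"
  shows "|L - R| =o |L - S|"
proof -
  define swap where "swap P Q x = (if x \<in> Q then THE r. r \<in> P \<inter> \<rho> `` {x} else x)" for P Q x
  have swap: "swap P Q x \<in> L - Q \<and> swap Q P (swap P Q x) = x"
    if P: "representatives L \<rho> P" and Q: "representatives L \<rho> Q" and x: "x \<in> L - P" for P Q x
  proof (cases "x \<in> Q")
    case True
    let ?C = "\<rho> `` {x}"
    have C: "?C \<in> L // \<rho>" using x by (simp add: quotientI)
    have xC: "x \<in> ?C" by (rule equiv_class_self[OF eq]) (use x in simp)
    have P1: "\<exists>!r. r \<in> P \<inter> ?C"
      using P C unfolding representatives_def by (elim conjE) (rule bspec)
    have Q1: "\<exists>!r. r \<in> Q \<inter> ?C"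
      using Q C unfolding representatives_def by (elim conjE) (rule bspec)
    define r where "r = (THE r. r \<in> P \<inter> ?C)"
    have r: "r \<in> P \<inter> ?C" unfolding r_def by (rule theI'[OF P1])
    then have "(x, r) \<in> \<rho>" by simp
    then have rx: "\<rho> `` {r} = ?C" by (simp add: equiv_class_eq[OF eq])
    have xQ: "x \<in> Q \<inter> ?C" using True xC by blast
    have "r \<notin> Q"
    proof
      assume "r \<in> Q"
      then have "r \<in> Q \<inter> ?C" using r by blast
      then have "r = x" using Q1 xQ by (elim ex1E) metis
      then show False using r x by blast
    qed
    moreover have "r \<in> L" using r P unfolding representatives_def by blast
    moreover have "(THE s. s \<in> Q \<inter> \<rho> `` {r}) = x"
      unfolding rx using Q1 xQ by (rule the1_equality)
    moreover have "r \<in> P" using r by blast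
    moreover have "swap P Q x = r" using True by (simp only: swap_def r_def if_True)
    ultimately show ?thesis by (simp only: swap_def) simp
  next
    case False
    then show ?thesis using x by (simp add: swap_def)
  qed
  have "bij_betw (swap R S) (L - R) (L - S)"
    by (rule bij_betw_byWitness[where f' = "swap S R"]) (use swap[OF R S] swap[OF S R] in blast)+
  then show ?thesis using card_of_ordIso[of "L - R" "L - S"] by (simp only: exI simp_thms)
qed

lemma equiv_ord_eq:
  assumes "equiv L \<rho>" "representatives L \<rho> R"
  shows "equiv_ord L \<rho> =o |L - R|"
  unfolding equiv_ord_def
  by (rule representatives_complement_unique[OF assms(1) someI_ex assms(2)])
    (rule representatives_exist[OF assms(1)])


section \<open>Latticeability\<close>

definition sublattice :: "'v::{real_vector, lattice} set \<Rightarrow> bool"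
  where "sublattice W \<longleftrightarrow> subspace W \<and> (\<forall>f\<in>W. \<forall>g\<in>W. sup f g \<in> W \<and> inf f g \<in> W)"

text \<open>
  The dimension is the cardinality of a basis. The library's \<^term>\<open>dim\<close> is a natural number, equal
  to 0 on infinite-dimensional spaces, and so cannot be used here.
\<close>

definition has_dimension :: "'v::real_vector set \<Rightarrow> 'c rel \<Rightarrow> bool"
  where "has_dimension W \<kappa> \<longleftrightarrow> (\<exists>B. independent B \<and> span B = W \<and> |B| =o \<kappa>)"

definition latticeable :: "'c rel \<Rightarrow> 'v::{real_vector, lattice} set \<Rightarrow> bool"
  where "latticeable \<kappa> M \<longleftrightarrow> (\<exists>W. sublattice W \<and> W \<subseteq> M \<union> {0} \<and> has_dimension W \<kappa>)"

end

theory Submission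
  imports Defs
begin

text \<open>
  Write \<open>\<sim>\<close> for the relation \<^term>\<open>same_values_rel A\<close>. By the Stone-Weierstrass theorem, the
  closure of \<open>A\<close> consists of all continuous functions that are constant on the classes of \<open>\<sim>\<close>
  (\<open>closure_subalgebra\<close>). Let \<open>R\<close> be a set of representatives, \<open>r x \<in> R\<close> the representative of \<open>x\<close>,
  and \<open>D\<close> the complement of \<open>R\<close>, a finite set with \<open>ord(\<sim>)\<close> elements. Then \<open>h\<close> lies in the closure
  of \<open>A\<close> if and only if \<open>h x = h (r x)\<close> for every \<open>x \<in> D\<close>: the closure is cut out by \<open>ord(\<sim>)\<close>
  linear equations.

  Take nonnegative functions \<open>g x\<close>, one for each \<open>x \<in> D\<close>, such that at each point of the space at
  most one of them is nonzero, \<open>g x\<close> has the value 1 at \<open>x\<close>, and it vanishes at the other points of the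
  finite set \<open>D \<union> r ` D\<close> (\<open>exists_disjoint_bumps\<close>). Lattice operations on linear combinations of the
  \<open>g x\<close> act coefficient by coefficient, because the functions are disjoint, so their span is a
  sublattice (\<open>sublattice_span_disjoint\<close>), of dimension \<open>ord(\<sim>)\<close>. An element \<open>h\<close> of the span has the
  coefficient \<open>h x\<close> at \<open>g x\<close> and vanishes at each \<open>r x\<close>; if it lies in the closure of \<open>A\<close>, then
  \<open>h x = h (r x) = 0\<close>, and \<open>h = 0\<close>.

  Conversely, the linear map that sends \<open>h\<close> to the combination of the \<open>g x\<close> with coefficients
  \<open>h x - h (r x)\<close> has the closure of \<open>A\<close> as its kernel. It is therefore injective on every subspace
  that meets this closure only in 0, and embeds such a subspace into a space of dimension \<open>ord(\<sim>)\<close>.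
\<close>

section \<open>Continuous functions on a compact space\<close>

lemma apply_bcontfun_times [simp]:
  "apply_bcontfun (f * g) x = apply_bcontfun f x * apply_bcontfun g x"
  by (simp add: times_bcontfun.rep_eq)

lemma apply_bcontfun_sum [simp]:
  "apply_bcontfun (sum f S) x = (\<Sum>i\<in>S. apply_bcontfun (f i) x)"
  by (induction S rule: infinite_finite_induct) auto

lemma bcontfun_of_continuous:
  fixes f :: "'a::topological_space \<Rightarrow> 'b::metric_space"
  assumes "compact (UNIV :: 'a set)" "continuous_on UNIV f"
  obtains F where "apply_bcontfun F = f"
proof (rule that)
  show "apply_bcontfun (Bcontfun f) = f"
    using assms(2) by (intro Bcontfun_inverse) (simp add: compact_UNIV_bcontfun_iff[OF assms(1)])
qed

lemma Hausdorff_space_euclidean_t2: "Hausdorff_space (euclidean :: 'a::t2_space topology)"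
  unfolding Hausdorff_space_def disjnt_def
  by (intro allI impI, elim conjE) (drule hausdorff, simp only: open_openin[symmetric] simp_thms)

section \<open>The Stone-Weierstrass theorem for algebras that need not separate points\<close>

text \<open>
  The Stone-Weierstrass theorem will be applied on a compact subset of a product space, which has to
  be known as a Hausdorff type. Arities have to be coregular along the subclass relation, and metrics
  on countable products already give separation arities for \<open>fun\<close>; hence the three separation axioms
  are established one after the other, starting with the weakest.
\<close>

lemma open_coordinate_vimage: "open W \<Longrightarrow> open ((\<lambda>f. f i) -` W)"
  by (rule open_vimage[OF _ continuous_on_product_coordinates])

instance "fun" :: (type, t0_space) t0_space
proof
  fix f g :: "'a \<Rightarrow> 'b"
  assume "f \<noteq> g"
  then obtain i where "f i \<noteq> g i" by blast
  then obtain U where "open U" "\<not> (f i \<in> U \<longleftrightarrow> g i \<in> U)" using t0_space_class.t0_space[OF \<open>f i \<noteq> g i\<close>] by blast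
  then show "\<exists>U. open U \<and> \<not> (f \<in> U \<longleftrightarrow> g \<in> U)"
    by (intro exI[of _ "(\<lambda>h. h i) -` U"]) (simp add: open_coordinate_vimage)
qed

instance "fun" :: (type, t1_space) t1_space
proof
  fix f g :: "'a \<Rightarrow> 'b"
  assume "f \<noteq> g"
  then obtain i where "f i \<noteq> g i" by blast
  then obtain U where "open U" "f i \<in> U" "g i \<notin> U" using t1_space[OF \<open>f i \<noteq> g i\<close>] by blast
  then show "\<exists>U. open U \<and> f \<in> U \<and> g \<notin> U"
    by (intro exI[of _ "(\<lambda>h. h i) -` U"]) (simp add: open_coordinate_vimage)
qed

instance "fun" :: (type, t2_space) t2_space
proof
  fix f g :: "'a \<Rightarrow> 'b"
  assume "f \<noteq> g"
  then obtain i where "f i \<noteq> g i" by blast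
  then obtain U V where UV: "open U" "open V" "f i \<in> U" "g i \<in> V" "U \<inter> V = {}"
    using hausdorff[OF \<open>f i \<noteq> g i\<close>] by blast
  have "open ((\<lambda>h. h i) -` U)" "open ((\<lambda>h. h i) -` V)"
    using UV by (simp_all only: open_coordinate_vimage)
  moreover have "f \<in> (\<lambda>h. h i) -` U" "g \<in> (\<lambda>h. h i) -` V" using UV by simp_all
  moreover have "(\<lambda>h. h i) -` U \<inter> (\<lambda>h. h i) -` V = {}" using UV(5) by blast
  ultimately show "\<exists>U V. open U \<and> open V \<and> f \<in> U \<and> g \<in> V \<and> U \<inter> V = {}"
    by (intro exI conjI)
qed

lemma continuous_factor_through_compact_image:
  fixes e :: "'a::topological_space \<Rightarrow> 'b::t2_space" and h :: "'a \<Rightarrow> 'c::topological_space"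
  assumes "compact (UNIV :: 'a set)" "continuous_on UNIV e" "continuous_on UNIV h"
    and "\<And>x y. e x = e y \<Longrightarrow> h x = h y"
  obtains k where "continuous_on (range e) k" "\<And>x. k (e x) = h x"
proof -
  have quotient: "quotient_map euclidean (top_of_set (range e)) e"
    using assms(1,2)
    by (intro T1_Spaces.continuous_imp_quotient_map)
      (auto simp: continuous_map_in_subtopology compact_space_def
        intro!: Hausdorff_space_subtopology Hausdorff_space_euclidean_t2)
  have h: "continuous_map euclidean euclidean h" using assms(3) by simp
  have fibres: "h x = h y" if "x \<in> topspace euclidean" "y \<in> topspace euclidean" "e x = e y" for x y
    using that(3) by (rule assms(4))
  show ?thesis
  proof (rule quotient_map_lift_exists[OF quotient h fibres])
    fix k
    assume "continuous_map (top_of_set (range e)) euclidean k"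
      and "\<And>x. x \<in> topspace euclidean \<Longrightarrow> k (e x) = h x"
    then show ?thesis by (intro that[of k]) simp_all
  qed
qed

text \<open>
  The quotient of the space by \<open>\<sim>\<close> is realised as the image of the evaluation map
  \<open>x \<mapsto> (f x)\<^sub>f\<close>, with \<open>f\<close> ranging over \<open>A\<close>, in a product of real lines. The image is compact, and
  its points are separated by the coordinate functions, which are the elements of \<open>A\<close> seen from the
  quotient. So the elements of \<open>A\<close>, together with the constants, satisfy the hypotheses of the usual
  Stone-Weierstrass theorem there.
\<close>

lemma subalgebra_with_constants_approximates:
  fixes A :: "('a::topological_space \<Rightarrow>\<^sub>C real) set"
  assumes compact: "compact (UNIV :: 'a set)" and A: "subalgebra A"
    and cont: "continuous_on UNIV h"
    and const: "\<And>x y. (x, y) \<in> same_values_rel A \<Longrightarrow> h x = h y"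
    and "0 < \<epsilon>"
  shows "\<exists>a\<in>A. \<exists>c. \<forall>x. \<bar>h x - (apply_bcontfun a x + c)\<bar> < \<epsilon>"
proof -
  \<comment> \<open>A type cannot depend on \<open>A\<close>, so the product has one factor for every bounded continuous function;
    the coordinates outside \<open>A\<close> are made constant and separate nothing.\<close>
  define e :: "'a \<Rightarrow> ('a \<Rightarrow>\<^sub>C real) \<Rightarrow> real"
    where "e x f = (if f \<in> A then apply_bcontfun f x else 0)" for x f
  have e_cont: "continuous_on UNIV e"
  proof (rule continuous_on_coordinatewise_then_product)
    show "continuous_on UNIV (\<lambda>x. e x f)" for f
      unfolding e_def by (cases "f \<in> A") simp_all
  qed
  have "(x, y) \<in> same_values_rel A" if "e x = e y" for x y
  proof -
    have "apply_bcontfun f x = apply_bcontfun f y" if "f \<in> A" for f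
      using fun_cong[OF \<open>e x = e y\<close>, of f] that by (simp add: e_def)
    then show ?thesis by (simp add: same_values_rel_def)
  qed
  then obtain k where k: "continuous_on (range e) k" "\<And>x. k (e x) = h x"
    using continuous_factor_through_compact_image[OF compact e_cont cont] const by metis
  define P where "P p \<longleftrightarrow> continuous_on (range e) p \<and>
    (\<exists>a\<in>A. \<exists>c. \<forall>x. p (e x) = apply_bcontfun a x + c)" for p
  have sub: "subspace A" and mul: "\<And>f g. f \<in> A \<Longrightarrow> g \<in> A \<Longrightarrow> f * g \<in> A"
    using A by (auto simp: subalgebra_def)
  have "\<exists>p. P p \<and> (\<forall>q\<in>range e. \<bar>k q - p q\<bar> < \<epsilon>)"
  proof (rule Stone_Weierstrass_HOL[where P = P])
    show "compact (range e)" using compact_continuous_image[OF e_cont compact] .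
    show "P (\<lambda>_. c)" for c
      unfolding P_def using subspace_0[OF sub] by (auto intro!: bexI[of _ 0])
    show "continuous_on (range e) f" if "P f" for f using that by (simp add: P_def)
    show "continuous_on (range e) k" by fact
    show "0 < \<epsilon>" by fact
  next
    fix p q assume pq: "P p \<and> P q"
    then obtain a b c d where ab: "a \<in> A" "b \<in> A"
      "\<And>x. p (e x) = apply_bcontfun a x + c" "\<And>x. q (e x) = apply_bcontfun b x + d"
      unfolding P_def by metis
    have *: "continuous_on (range e) p" "continuous_on (range e) q" using pq by (auto simp: P_def)
    show "P (\<lambda>x. p x + q x)"
      unfolding P_def
    proof (intro conjI bexI exI allI)
      show "a + b \<in> A" using ab sub by (simp add: subspace_add)
      show "p (e x) + q (e x) = apply_bcontfun (a + b) x + (c + d)" for x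
        by (simp add: ab)
    qed (intro continuous_intros *)
    show "P (\<lambda>x. p x * q x)"
      unfolding P_def
    proof (intro conjI bexI exI allI)
      show "a * b + d *\<^sub>R a + c *\<^sub>R b \<in> A"
        using ab sub by (intro subspace_add subspace_scale mul)
      show "p (e x) * q (e x) = apply_bcontfun (a * b + d *\<^sub>R a + c *\<^sub>R b) x + c * d" for x
        by (simp add: ab algebra_simps)
    qed (intro continuous_intros *)
  next
    fix p q assume "p \<in> range e \<and> q \<in> range e \<and> p \<noteq> q"
    then obtain f where f: "p f \<noteq> q f" "f \<in> A"
      by (auto simp: fun_eq_iff e_def split: if_splits)
    have "P (\<lambda>p. p f)"
      unfolding P_def
    proof (intro conjI bexI exI allI)
      show "continuous_on (range e) (\<lambda>p. p f)"
        by (rule continuous_on_subset[OF continuous_on_product_coordinates]) auto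
      show "e x f = apply_bcontfun f x + 0" for x using f by (simp add: e_def)
    qed (use f in auto)
    then show "\<exists>g. P g \<and> g p \<noteq> g q" using f(1) by blast
  qed
  then show ?thesis unfolding P_def using k(2) by (metis rangeI)
qed

text \<open>
  Squares do not cancel: a sum of squares of finitely many elements of \<open>A\<close> is positive wherever one
  of these elements is nonzero, and by compactness finitely many suffice for the whole space.
\<close>

lemma exists_positive_in_subalgebra:
  fixes A :: "('a::topological_space \<Rightarrow>\<^sub>C real) set"
  assumes compact: "compact (UNIV :: 'a set)" and A: "subalgebra A" "vanishes_nowhere A"
  obtains u where "u \<in> A" "\<And>x. 0 < apply_bcontfun u x"
proof -
  obtain f where f: "\<And>x. f x \<in> A" "\<And>x. apply_bcontfun (f x) x \<noteq> 0"
    using A(2) unfolding vanishes_nowhere_def by metis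
  define U where "U x = {y. apply_bcontfun (f x) y \<noteq> 0}" for x
  have op: "open (U x)" for x
    unfolding U_def by (intro open_Collect_neq continuous_on_apply_bcontfun continuous_on_const)
  have "UNIV \<subseteq> (\<Union>x\<in>UNIV. U x)" using f by (auto simp: U_def)
  then obtain C where C: "finite C" "UNIV \<subseteq> (\<Union>x\<in>C. U x)"
    using compactE_image[OF compact, of UNIV U] op by metis
  show ?thesis
  proof
    show "(\<Sum>x\<in>C. f x * f x) \<in> A"
      using A f by (auto simp: subalgebra_def intro!: subspace_sum)
    fix y
    obtain x where "x \<in> C" "apply_bcontfun (f x) y \<noteq> 0" using C by (auto simp: U_def)
    then show "0 < apply_bcontfun (\<Sum>x\<in>C. f x * f x) y"
      using C(1) by (auto intro!: sum_pos2[of C x] simp: zero_less_mult_iff linorder_neq_iff)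
  qed
qed

text \<open>
  The constants needed for the Stone-Weierstrass theorem may be missing from \<open>A\<close>. If \<open>u \<in> A\<close> is
  positive everywhere and \<open>h\<close> is constant on the classes of \<open>\<sim>\<close>, then so is \<open>h / u\<close>. An approximation
  \<open>a + c\<close> of \<open>h / u\<close>, with \<open>a \<in> A\<close> and a constant \<open>c\<close>, becomes after multiplication by \<open>u\<close> the
  approximation \<open>u * a + c u\<close> of \<open>h\<close>, which belongs to \<open>A\<close>.
\<close>

theorem closure_subalgebra:
  fixes A :: "('a::topological_space \<Rightarrow>\<^sub>C real) set"
  assumes compact: "compact (UNIV :: 'a set)" and A: "subalgebra A" "vanishes_nowhere A"
  shows "closure A = {h. \<forall>(x, y) \<in> same_values_rel A. apply_bcontfun h x = apply_bcontfun h y}"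
    (is "_ = ?C")
proof
  show "closure A \<subseteq> ?C"
  proof clarify
    fix h x y assume h: "h \<in> closure A" and xy: "(x, y) \<in> same_values_rel A"
    have "dist (apply_bcontfun h x) (apply_bcontfun h y) < \<epsilon>" if \<epsilon>: "0 < \<epsilon>" for \<epsilon>
    proof -
      obtain a where a: "a \<in> A" "dist a h < \<epsilon> / 2"
        using h \<epsilon> unfolding closure_approachable by (meson half_gt_zero)
      have "apply_bcontfun a x = apply_bcontfun a y" using xy a by (simp add: same_values_rel_def)
      then show ?thesis
        using dist_fun_lt_imp_dist_val_lt[OF a(2), of x] dist_fun_lt_imp_dist_val_lt[OF a(2), of y]
        by (simp add: dist_real_def) argo
    qed
    then show "apply_bcontfun h x = apply_bcontfun h y"
      by (metis dist_eq_0_iff less_irrefl zero_less_dist_iff)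
  qed
next
  obtain u where u: "u \<in> A" "\<And>x. 0 < apply_bcontfun u x"
    using exists_positive_in_subalgebra[OF assms] by blast
  show "?C \<subseteq> closure A"
  proof
    fix h assume h: "h \<in> ?C"
    show "h \<in> closure A"
      unfolding closure_approachable
    proof safe
      fix \<epsilon> :: real assume "0 < \<epsilon>"
      let ?q = "\<lambda>x. apply_bcontfun h x / apply_bcontfun u x"
      \<comment> \<open>Multiplication by \<open>u\<close> enlarges the error by at most the factor \<open>norm u\<close>; the added 1 only keeps
        the denominator visibly nonzero.\<close>
      let ?\<delta> = "\<epsilon> / (2 * (norm u + 1))"
      have pos: "0 < norm u + 1" by (simp add: add_nonneg_pos)
      have "\<exists>a\<in>A. \<exists>c. \<forall>x. \<bar>?q x - (apply_bcontfun a x + c)\<bar> < ?\<delta>"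
      proof (rule subalgebra_with_constants_approximates[OF compact A(1)])
        show "continuous_on UNIV ?q"
          using u(2) by (intro continuous_intros) (auto simp: less_imp_neq[symmetric])
        show "?q x = ?q y" if "(x, y) \<in> same_values_rel A" for x y
          using that h u(1) by (auto simp: same_values_rel_def)
        show "0 < ?\<delta>" using \<open>0 < \<epsilon>\<close> pos by simp
      qed
      then obtain a c where a: "a \<in> A" "\<And>x. \<bar>?q x - (apply_bcontfun a x + c)\<bar> < ?\<delta>" by blast
      show "\<exists>b\<in>A. dist b h < \<epsilon>"
      proof (intro bexI)
        show "u * a + c *\<^sub>R u \<in> A"
          using A u a by (auto simp: subalgebra_def intro!: subspace_add subspace_scale)
        have "dist (u * a + c *\<^sub>R u) h \<le> \<epsilon> / 2"
        proof (rule dist_bound)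
          fix x
          have "dist (apply_bcontfun (u * a + c *\<^sub>R u) x) (apply_bcontfun h x)
              = \<bar>apply_bcontfun u x * (?q x - (apply_bcontfun a x + c))\<bar>"
          proof -
            have "apply_bcontfun u x * ?q x = apply_bcontfun h x" using u(2)[of x] by simp
            then show ?thesis by (simp add: dist_real_def abs_minus_commute algebra_simps)
          qed
          also have "\<dots> \<le> (norm u + 1) * ?\<delta>"
            unfolding abs_mult
            using norm_bounded[of u x] a(2)[of x] pos
            by (intro mult_mono less_imp_le[OF a(2)]) auto
          also have "\<dots> = \<epsilon> / 2" using pos by (simp add: field_simps)
          finally show "dist (apply_bcontfun (u * a + c *\<^sub>R u) x) (apply_bcontfun h x) \<le> \<epsilon> / 2" .
        qed
        then show "dist (u * a + c *\<^sub>R u) h < \<epsilon>" using \<open>0 < \<epsilon>\<close> by simp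
      qed
    qed
  qed
qed

section \<open>Sublattices spanned by disjoint functions\<close>

text \<open>
  Urysohn functions \<open>u x\<close> with \<open>u x y = 0\<close> at the other points \<open>y\<close> of \<open>F\<close> may overlap elsewhere.
  Subtracting from each the sum of all the others and taking the positive part makes them disjoint:
  two of them cannot both exceed a sum that contains the other one. At the points of \<open>F\<close> nothing
  changes.
\<close>

lemma exists_disjoint_bumps:
  fixes F :: "'a::t2_space set"
  assumes compact: "compact (UNIV :: 'a set)" and F: "finite F"
  obtains g :: "'a \<Rightarrow> ('a \<Rightarrow>\<^sub>C real)"
  where "\<And>x z. 0 \<le> apply_bcontfun (g x) z"
    and "\<And>x y. x \<in> F \<Longrightarrow> y \<in> F \<Longrightarrow> apply_bcontfun (g x) y = of_bool (x = y)"
    and "\<And>x y z. x \<in> F \<Longrightarrow> y \<in> F \<Longrightarrow> x \<noteq> y \<Longrightarrow>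
      apply_bcontfun (g x) z = 0 \<or> apply_bcontfun (g y) z = 0"
proof -
  have normal: "normal_space (euclidean :: 'a topology)"
    using compact by (intro compact_Hausdorff_or_regular_imp_normal_space)
      (auto simp: compact_space_def Hausdorff_space_euclidean_t2)
  have "\<exists>u. continuous_on UNIV u \<and> (\<forall>z. 0 \<le> u z) \<and> u x = 1 \<and> (\<forall>y\<in>F - {x}. u y = (0::real))" for x
  proof -
    have "closedin euclidean (F - {x})" "closedin euclidean {x}" "disjnt (F - {x}) {x}"
      using F by (auto simp: finite_imp_closed disjnt_def)
    then obtain u where "continuous_map euclidean (top_of_set {0..1::real}) u"
        "u ` (F - {x}) \<subseteq> {0}" "u ` {x} \<subseteq> {1}"
      using Urysohn_lemma[OF normal, of "F - {x}" "{x}" 0 1] by auto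
    then show ?thesis
      by (intro exI[of _ u]) (auto simp: continuous_map_in_subtopology)
  qed
  then obtain u where u: "\<And>x. continuous_on UNIV (u x)" "\<And>x z. 0 \<le> u x z" "\<And>x. u x x = 1"
      "\<And>x y. y \<in> F - {x} \<Longrightarrow> u x y = (0::real)"
    by metis
  define v where "v x z = max 0 (u x z - (\<Sum>w\<in>F - {x}. u w z))" for x z
  have "continuous_on UNIV (v x)" for x
    unfolding v_def by (intro continuous_intros u)
  then have "\<exists>G. apply_bcontfun G = v x" for x
    using bcontfun_of_continuous[OF compact] by metis
  then obtain g where g: "\<And>x. apply_bcontfun (g x) = v x" by metis
  have disj: "v x z = 0 \<or> v y z = 0" if "x \<in> F" "y \<in> F" "x \<noteq> y" for x y z
  proof -
    have "u y z \<le> (\<Sum>w\<in>F - {x}. u w z)" "u x z \<le> (\<Sum>w\<in>F - {y}. u w z)"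
      using that F u(2) by (auto intro!: member_le_sum)
    then show ?thesis unfolding v_def by linarith
  qed
  have diag: "v x x = 1" if "x \<in> F" for x
  proof -
    have "(\<Sum>w\<in>F - {x}. u w x) = 0" using u(4)[of x] that by (intro sum.neutral ballI) auto
    then show ?thesis by (simp add: v_def u)
  qed
  show ?thesis
  proof
    show "0 \<le> apply_bcontfun (g x) z" for x z by (simp add: g v_def)
    show "apply_bcontfun (g x) y = of_bool (x = y)" if "x \<in> F" "y \<in> F" for x y
      using disj[OF that, of y] diag that by (auto simp: g)
    show "apply_bcontfun (g x) z = 0 \<or> apply_bcontfun (g y) z = 0"
      if "x \<in> F" "y \<in> F" "x \<noteq> y" for x y z
      using disj[OF that] by (simp add: g)
  qed
qed

lemma span_finite_image:
  fixes g :: "'i \<Rightarrow> 'v::real_vector"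
  assumes "finite D"
  shows "span (g ` D) = range (\<lambda>c. \<Sum>x\<in>D. c x *\<^sub>R g x)"
proof
  show "range (\<lambda>c. \<Sum>x\<in>D. c x *\<^sub>R g x) \<subseteq> span (g ` D)"
    by (auto intro!: span_sum intro: span_scale span_base)
  have "subspace (range (\<lambda>c. \<Sum>x\<in>D. c x *\<^sub>R g x))" (is "subspace ?S")
  proof (rule subspaceI)
    show "0 \<in> ?S" by (rule range_eqI[of _ _ "\<lambda>_. 0"]) simp
    show "p + q \<in> ?S" if pq: "p \<in> ?S" "q \<in> ?S" for p q
    proof -
      obtain c d where "p = (\<Sum>x\<in>D. c x *\<^sub>R g x)" "q = (\<Sum>x\<in>D. d x *\<^sub>R g x)"
        using pq by blast
      then show ?thesis
        by (intro range_eqI[of _ _ "\<lambda>x. c x + d x"]) (simp add: scaleR_add_left sum.distrib)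
    qed
    show "t *\<^sub>R p \<in> ?S" if p: "p \<in> ?S" for t p
    proof -
      obtain c where "p = (\<Sum>x\<in>D. c x *\<^sub>R g x)" using p by blast
      then show ?thesis
        by (intro range_eqI[of _ _ "\<lambda>x. t * c x"]) (simp add: scaleR_sum_right)
    qed
  qed
  moreover have "g x \<in> ?S" if "x \<in> D" for x
    using that assms
    by (intro range_eqI[of _ _ "\<lambda>y. of_bool (y = x)"])
      (simp add: of_bool_def if_distrib[of "\<lambda>c. c *\<^sub>R _"] cong: if_cong)
  ultimately show "span (g ` D) \<subseteq> ?S" by (intro span_minimal) auto
qed

text \<open>
  At any given point at most one of the functions contributes to a linear combination, and its value
  there is nonnegative, so maxima and minima of combinations are those of the coefficients.
\<close>

lemma sublattice_span_disjoint:
  fixes g :: "'i \<Rightarrow> ('a::topological_space \<Rightarrow>\<^sub>C real)"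
  assumes D: "finite D"
    and nonneg: "\<And>x z. x \<in> D \<Longrightarrow> 0 \<le> apply_bcontfun (g x) z"
    and disj: "\<And>x y z. x \<in> D \<Longrightarrow> y \<in> D \<Longrightarrow> x \<noteq> y \<Longrightarrow>
      apply_bcontfun (g x) z = 0 \<or> apply_bcontfun (g y) z = 0"
  shows "sublattice (span (g ` D))"
proof -
  have single: "(\<Sum>y\<in>D. c y * apply_bcontfun (g y) z) = c x * apply_bcontfun (g x) z"
    if "x \<in> D" "apply_bcontfun (g x) z \<noteq> 0" for c x z
  proof -
    have "(\<Sum>y\<in>D - {x}. c y * apply_bcontfun (g y) z) = 0"
      using disj that by (intro sum.neutral) fastforce
    then show ?thesis using sum.remove[OF D that(1), of "\<lambda>y. c y * apply_bcontfun (g y) z"] by simp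
  qed
  have coefficientwise: "(\<Sum>x\<in>D. max (c x) (d x) *\<^sub>R g x) = sup (\<Sum>x\<in>D. c x *\<^sub>R g x) (\<Sum>x\<in>D. d x *\<^sub>R g x)"
    "(\<Sum>x\<in>D. min (c x) (d x) *\<^sub>R g x) = inf (\<Sum>x\<in>D. c x *\<^sub>R g x) (\<Sum>x\<in>D. d x *\<^sub>R g x)" for c d
  proof -
    have "(\<Sum>x\<in>D. max (c x) (d x) * apply_bcontfun (g x) z)
        = max (\<Sum>x\<in>D. c x * apply_bcontfun (g x) z) (\<Sum>x\<in>D. d x * apply_bcontfun (g x) z)
      \<and> (\<Sum>x\<in>D. min (c x) (d x) * apply_bcontfun (g x) z)
        = min (\<Sum>x\<in>D. c x * apply_bcontfun (g x) z) (\<Sum>x\<in>D. d x * apply_bcontfun (g x) z)" for z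
    proof (cases "\<exists>x\<in>D. apply_bcontfun (g x) z \<noteq> 0")
      case True
      then obtain x where x: "x \<in> D" "apply_bcontfun (g x) z \<noteq> 0" by blast
      show ?thesis
        unfolding single[OF x]
        using nonneg[OF x(1), of z] by (simp add: max_mult_distrib_right min_mult_distrib_right)
    qed auto
    then show "(\<Sum>x\<in>D. max (c x) (d x) *\<^sub>R g x) = sup (\<Sum>x\<in>D. c x *\<^sub>R g x) (\<Sum>x\<in>D. d x *\<^sub>R g x)"
      "(\<Sum>x\<in>D. min (c x) (d x) *\<^sub>R g x) = inf (\<Sum>x\<in>D. c x *\<^sub>R g x) (\<Sum>x\<in>D. d x *\<^sub>R g x)"
      by (auto intro!: bcontfun_eqI simp: sup_bcontfun.rep_eq inf_bcontfun.rep_eq)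
  qed
  have "sup p q \<in> span (g ` D) \<and> inf p q \<in> span (g ` D)"
    if pq: "p \<in> span (g ` D)" "q \<in> span (g ` D)" for p q
  proof -
    obtain c d where "p = (\<Sum>x\<in>D. c x *\<^sub>R g x)" "q = (\<Sum>x\<in>D. d x *\<^sub>R g x)"
      using pq unfolding span_finite_image[OF D] by blast
    then show ?thesis
      unfolding span_finite_image[OF D] by (simp flip: coefficientwise)
  qed
  then show ?thesis by (simp add: sublattice_def)
qed

text \<open>
  Evaluation at the points of \<open>D\<close> gives functionals dual to the functions \<open>g x\<close>, which recover the
  coefficients of a linear combination.
\<close>

lemma independent_biorthogonal:
  fixes g :: "'a \<Rightarrow> ('a::topological_space \<Rightarrow>\<^sub>C real)"
  assumes D: "finite D"
    and delta: "\<And>x y. x \<in> D \<Longrightarrow> y \<in> D \<Longrightarrow> apply_bcontfun (g x) y = of_bool (x = y)"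
  shows "inj_on g D" "independent (g ` D)"
proof -
  show inj: "inj_on g D"
  proof (rule inj_onI)
    fix x y assume "x \<in> D" "y \<in> D" "g x = g y"
    then have "of_bool (x = x) = (of_bool (y = x) :: real)" by (metis delta)
    then show "x = y" by (simp split: if_splits)
  qed
  show "independent (g ` D)"
  proof (rule independent_if_scalars_zero)
    show "finite (g ` D)" using D by simp
    fix c w assume c: "(\<Sum>w\<in>g ` D. c w *\<^sub>R w) = 0" and "w \<in> g ` D"
    then obtain y where y: "y \<in> D" "w = g y" by blast
    have "0 = apply_bcontfun (\<Sum>x\<in>D. c (g x) *\<^sub>R g x) y"
      using c by (simp add: sum.reindex[OF inj])
    also have "\<dots> = (\<Sum>x\<in>D. if x = y then c (g x) else 0)"
      using y by (auto intro!: sum.cong simp: delta)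
    also have "\<dots> = c w" using y D by simp
    finally show "c w = 0" by simp
  qed
qed

section \<open>Representatives and the dimension count\<close>

lemma representative_map:
  assumes eq: "equiv UNIV \<rho>" and R: "representatives UNIV \<rho> R"
  obtains r where "\<And>x. r x \<in> R" "\<And>x. (x, r x) \<in> \<rho>" "\<And>x y. (x, y) \<in> \<rho> \<Longrightarrow> r x = r y"
    "\<And>x. x \<in> R \<Longrightarrow> r x = x"
proof -
  define r where "r x = (THE y. y \<in> R \<inter> \<rho> `` {x})" for x
  have ex1: "\<exists>!y. y \<in> R \<inter> \<rho> `` {x}" for x
    using R quotientI[of x UNIV \<rho>] by (auto simp: representatives_def)
  have r: "r x \<in> R \<inter> \<rho> `` {x}" for x unfolding r_def by (rule theI'[OF ex1])
  show ?thesis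
  proof
    show "r x \<in> R" "(x, r x) \<in> \<rho>" for x using r[of x] by auto
    show "r x = r y" if "(x, y) \<in> \<rho>" for x y
      using equiv_class_eq[OF eq that] by (simp add: r_def)
    show "r x = x" if "x \<in> R" for x
      using ex1[of x] r[of x] that equiv_class_self[OF eq, of x] by blast
  qed
qed

theorem corollary3p3:
  fixes A :: "('a::t2_space \<Rightarrow>\<^sub>C real) set"
  assumes "compact (UNIV :: 'a set)"
    and "subalgebra A"
    and "vanishes_nowhere A"
    and "finite_equiv UNIV (same_values_rel A)"
  shows "latticeable (equiv_ord UNIV (same_values_rel A)) (UNIV - closure A) \<and>
    \<not> latticeable (equiv_ord UNIV (same_values_rel A) +c |{()}| ) (UNIV - closure A)"
proof -
  note equiv = equiv_same_values_rel[of A]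
  define R where "R = (SOME R. representatives UNIV (same_values_rel A) R)"
  have R: "representatives UNIV (same_values_rel A) R"
    unfolding R_def by (rule someI_ex[OF representatives_exist[OF equiv]])
  define D where "D = UNIV - R"
  have ord: "equiv_ord UNIV (same_values_rel A) = |D|"
    by (simp add: equiv_ord_def D_def R_def)
  have D: "finite D"
    using assms(4) by (simp add: finite_equiv_def ord BNF_Cardinal_Arithmetic.cfinite_def Field_card_of)
  obtain r where r: "\<And>x. r x \<in> R" "\<And>x. (x, r x) \<in> same_values_rel A"
    "\<And>x y. (x, y) \<in> same_values_rel A \<Longrightarrow> r x = r y" "\<And>x. x \<in> R \<Longrightarrow> r x = x"
    by (rule representative_map[OF equiv R]) (rule that)
  have closure: "h \<in> closure A \<longleftrightarrow> (\<forall>x\<in>D. apply_bcontfun h x = apply_bcontfun h (r x))" for h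
  proof
    show "\<forall>x\<in>D. apply_bcontfun h x = apply_bcontfun h (r x)" if "h \<in> closure A"
      using that r(2) unfolding closure_subalgebra[OF assms(1-3)] by blast
  next
    assume "\<forall>x\<in>D. apply_bcontfun h x = apply_bcontfun h (r x)"
    then have *: "apply_bcontfun h x = apply_bcontfun h (r x)" for x
      using r(4)[of x] by (cases "x \<in> R") (auto simp: D_def)
    have "apply_bcontfun h x = apply_bcontfun h y" if "(x, y) \<in> same_values_rel A" for x y
      using *[of x] *[of y] r(3)[OF that] by simp
    then show "h \<in> closure A"
      unfolding closure_subalgebra[OF assms(1-3)] by blast
  qed
  \<comment> \<open>The bumps at points of \<open>D\<close> must also vanish at the representatives \<open>r x\<close>, hence the larger set.\<close>
  obtain g :: "'a \<Rightarrow> ('a \<Rightarrow>\<^sub>C real)" where g: "\<And>x z. 0 \<le> apply_bcontfun (g x) z"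
    "\<And>x y. x \<in> D \<union> r ` D \<Longrightarrow> y \<in> D \<union> r ` D \<Longrightarrow> apply_bcontfun (g x) y = of_bool (x = y)"
    "\<And>x y z. x \<in> D \<union> r ` D \<Longrightarrow> y \<in> D \<union> r ` D \<Longrightarrow> x \<noteq> y \<Longrightarrow>
      apply_bcontfun (g x) z = 0 \<or> apply_bcontfun (g y) z = 0"
    by (rule exists_disjoint_bumps[OF assms(1), of "D \<union> r ` D"]) (simp add: D, rule that)
  have inj: "inj_on g D" and indep: "independent (g ` D)"
    using g(2) by (intro independent_biorthogonal[OF D]; simp)+
  have coeff: "apply_bcontfun (\<Sum>x\<in>D. c x *\<^sub>R g x) y = c y" if "y \<in> D" for c y
  proof -
    have "apply_bcontfun (\<Sum>x\<in>D. c x *\<^sub>R g x) y = (\<Sum>x\<in>D. if x = y then c x else 0)"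
      using that by (auto intro!: sum.cong simp: g(2))
    then show ?thesis using that D by simp
  qed
  have "latticeable |D| (UNIV - closure A)"
    unfolding latticeable_def
  proof (intro exI conjI)
    show "sublattice (span (g ` D))"
      using g by (intro sublattice_span_disjoint[OF D]) auto
    show "span (g ` D) \<subseteq> UNIV - closure A \<union> {0}"
    proof
      fix h assume "h \<in> span (g ` D)"
      then obtain c where h: "h = (\<Sum>x\<in>D. c x *\<^sub>R g x)"
        unfolding span_finite_image[OF D] by blast
      have "h = 0" if "h \<in> closure A"
      proof -
        have "c y = 0" if "y \<in> D" for y
        proof -
          have "c y = apply_bcontfun h (r y)"
            using \<open>h \<in> closure A\<close> \<open>y \<in> D\<close> coeff closure h by metis
          also have "\<dots> = 0"
            using \<open>y \<in> D\<close> r(1)[of y] by (auto simp: h g(2) D_def intro!: sum.neutral)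
          finally show ?thesis .
        qed
        then show ?thesis by (simp add: h)
      qed
      then show "h \<in> UNIV - closure A \<union> {0}" by blast
    qed
    have "|g ` D| =o |D|"
      using inj card_of_ordIso[of D "g ` D"] ordIso_symmetric by (metis bij_betw_imageI)
    then show "has_dimension (span (g ` D)) |D|"
      using indep unfolding has_dimension_def by blast
  qed
  moreover have "\<not> latticeable ( |D| +c |{()}| ) (UNIV - closure A)"
  proof
    assume "latticeable ( |D| +c |{()}| ) (UNIV - closure A)"
    then obtain B where B: "span B \<subseteq> UNIV - closure A \<union> {0}" "independent B" "|B| =o |D| +c |{()}|"
      unfolding latticeable_def has_dimension_def by blast
    have "|B| =o |D <+> {()}|" using B(3) by (simp add: csum_def Field_card_of)
    then obtain b where "bij_betw b B (D <+> {()})" using card_of_ordIso by metis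
    then have card: "card B = Suc (card D)"
      using bij_betw_same_card D by (fastforce simp: card_Plus)
    \<comment> \<open>A linear map into the span of the bumps whose kernel is the closure of \<open>A\<close>.\<close>
    define T where "T h = (\<Sum>x\<in>D. (apply_bcontfun h x - apply_bcontfun h (r x)) *\<^sub>R g x)" for h
    have T: "linear T"
      by (rule linearI)
        (simp_all add: T_def algebra_simps sum.distrib scaleR_sum_right sum_subtractf)
    have "h = 0" if "h \<in> span B" "T h = 0" for h
    proof -
      have "h \<in> closure A"
        unfolding closure
      proof
        fix x assume "x \<in> D"
        then show "apply_bcontfun h x = apply_bcontfun h (r x)"
          using coeff[of x "\<lambda>x. apply_bcontfun h x - apply_bcontfun h (r x)"] that(2)
          by (simp add: T_def[symmetric] del: apply_bcontfun_sum)
      qed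
      then show ?thesis using B(1) that(1) by blast
    qed
    then have T_inj: "inj_on T (span B)"
      using linear_injective_on_subspace_0[OF T subspace_span] by blast
    have "independent (T ` B)"
      using linear_independent_injective_image[OF T B(2) T_inj] .
    moreover have "T ` B \<subseteq> span (g ` D)"
      unfolding span_finite_image[OF D] by (auto simp: T_def)
    ultimately have "card (T ` B) \<le> card (g ` D)"
      using independent_span_bound[of "g ` D" "T ` B"] D by simp
    moreover have "card (T ` B) = card B"
      by (rule card_image[OF inj_on_subset[OF T_inj span_superset]])
    ultimately show False
      using card card_image_le[OF D, of g] by simp
  qed
  ultimately show ?thesis unfolding ord by (rule conjI)
qed

end
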